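(* Let $\Omega\subset\mathbb{R}^N$ be an open set, $N\geq 1$, $p>1$, $A\in C^1(\Omega)$ with $A\geq 0$, and $X\in C^1(\Omega,\mathbb{R}^N)$. Then for any $u\in C_0^1(\Omega)$, $$\int_{\Omega}A|\nabla u|^{p}\,dx\geq\int_{\Omega}A\left|\frac{X}{|X|}\cdot\nabla u\right|^{p}dx\geq\int_{\Omega}\left(-\operatorname{div}\left(A|X|^{p-2}X\right)-(p-1)A|X|^{p}\right)|u|^{p}\,dx$$ and $$\left(\int_{\Omega}A|\nabla u|^{p}dx\right)^{\frac1p}\left(\int_{\Omega}A|X|^{p}|u|^{p}dx\right)^{\frac{p-1}{p}}\geq\left(\int_{\Omega}A\left|\frac{X}{|X|}\cdot\nabla u\right|^{p}dx\right)^{\frac1p}\left(\int_{\Omega}A|X|^{p}|u|^{p}dx\right)^{\frac{p-1}{p}}\geq-\frac1p\int_{\Omega}\operatorname{div}\left(A|X|^{p-2}X\right)|u|^{p}\,dx.$$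
   Context: Functions are real valued and $C_0^1(\Omega)$ denotes $C^1$ functions with compact support in $\Omega$. Conventions: $|X|^{p-2}X:=0$ and $\frac{X}{|X|}:=0$ at points where $X=0$. If $A|X|^{p-2}X$ is not $C^1$ (possible when $1<p<2$ and $X$ has zeros), its divergence is understood in the distributional sense, i.e. $-\int_\Omega \operatorname{div}(A|X|^{p-2}X)|u|^p\,dx$ means $\int_\Omega A|X|^{p-2}X\cdot\nabla(|u|^p)\,dx$. *)

theory Defs
  imports "HOL-Analysis.Analysis"
begin

definition C1_on :: "'a::euclidean_space set \<Rightarrow> ('a \<Rightarrow> 'b::real_normed_vector) \<Rightarrow> bool" where
  "C1_on \<Omega> f \<longleftrightarrow>
    (\<exists>f'. (\<forall>x\<in>\<Omega>. (f has_derivative blinfun_apply (f' x)) (at x)) \<and> continuous_on \<Omega> f')"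

(* Only the restriction of f to \<Omega> matters; the closure is taken in the whole space. *)
definition C1_compact_support_on :: "'a::euclidean_space set \<Rightarrow> ('a \<Rightarrow> real) \<Rightarrow> bool" where
  "C1_compact_support_on \<Omega> f \<longleftrightarrow>
    C1_on \<Omega> f \<and> compact (closure (support_on \<Omega> f)) \<and> closure (support_on \<Omega> f) \<subseteq> \<Omega>"

definition grad :: "(real^'n \<Rightarrow> real) \<Rightarrow> real^'n \<Rightarrow> real^'n" where
  "grad f x = (\<chi> i. frechet_derivative f (at x) (axis i 1))"

definition divergence :: "(real^'n \<Rightarrow> real^'n) \<Rightarrow> real^'n \<Rightarrow> real" where
  "divergence F x = (\<Sum>i\<in>UNIV. frechet_derivative F (at x) (axis i 1) $ i)"

(* |X|^(p-2) X; it is 0 where X = 0, because 0 powr a = 0 for every a and because of the factor X. *)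
definition p_field :: "real \<Rightarrow> real^'n \<Rightarrow> real^'n" where
  "p_field p X = (norm X powr (p - 2)) *\<^sub>R X"

(* The integral of div F * \<phi> over \<Omega>: classical if F is C1, in the sense of distributions otherwise. *)
definition div_integral :: "(real^'n) set \<Rightarrow> (real^'n \<Rightarrow> real^'n) \<Rightarrow> (real^'n \<Rightarrow> real) \<Rightarrow> real" where
  "div_integral \<Omega> F \<phi> =
    (if C1_on \<Omega> F then (LINT x:\<Omega>|lborel. divergence F x * \<phi> x)
     else - (LINT x:\<Omega>|lborel. F x \<bullet> grad \<phi> x))"

(* The integral of (- div F - V) * \<phi> over \<Omega>, with the same convention for div F. *)
definition neg_div_minus_integral ::
  "(real^'n) set \<Rightarrow> (real^'n \<Rightarrow> real^'n) \<Rightarrow> (real^'n \<Rightarrow> real) \<Rightarrow> (real^'n \<Rightarrow> real) \<Rightarrow> real" where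
  "neg_div_minus_integral \<Omega> F V \<phi> =
    (if C1_on \<Omega> F then (LINT x:\<Omega>|lborel. (- divergence F x - V x) * \<phi> x)
     else - div_integral \<Omega> F \<phi> - (LINT x:\<Omega>|lborel. V x * \<phi> x))"

end

theory Submission
  imports Defs
begin

text \<open>Write \<open>F = A |X|^(p-2) X\<close> and \<open>\<phi> = |u|^p\<close>. Since \<open>p > 1\<close>, the map \<open>t \<mapsto> |t|^p\<close> is
  continuously differentiable with derivative \<open>p |t|^(p-2) t\<close>, so \<open>\<phi>\<close> is again a \<open>C\<^sup>1\<close> function with
  compact support, and \<open>F\<close> is continuous also across the zeros of \<open>X\<close>. Integration by parts moves
  the divergence from \<open>F\<close> to \<open>\<phi>\<close>; when \<open>F\<close> is not \<open>C\<^sup>1\<close> this is what the divergence means. Hence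
  in every case both right-hand sides are expressed through one quantity, the integral of
  \<open>F \<bullet> grad \<phi>\<close> (\<open>div_integral_eq\<close>, \<open>neg_div_minus_integral_eq\<close>), and the classical and
  the distributional case need no separate treatment afterwards.

  With \<open>a = |(X/|X|) \<bullet> grad u|\<close> and \<open>b = |X| |u|\<close> the chain rule gives the pointwise bound
  \<open>F \<bullet> grad \<phi> \<le> p A a b^(p-1)\<close> (\<open>p_field_inner_grad_le\<close>). Young's inequality
  \<open>p a b^(p-1) \<le> a^p + (p-1) b^p\<close> bounds the integral additively, which is the second inequality;
  Hoelder's inequality applied to \<open>A^(1/p) a\<close> and \<open>A^((p-1)/p) b^(p-1)\<close> bounds it by a product,
  which is the fourth. The first and third inequalities are the Cauchy-Schwarz bound
  \<open>a \<le> |grad u|\<close>.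

  Integration by parts for compactly supported functions rests on
  \<open>integral_frechet_derivative_eq_0\<close>: a directional derivative is the limit of difference
  quotients, whose integrals vanish because Lebesgue measure is translation invariant.\<close>

section \<open>Continuously differentiable functions on an open set\<close>

lemma C1_on_has_derivative:
  assumes "C1_on \<Omega> f" "x \<in> \<Omega>"
  shows "(f has_derivative frechet_derivative f (at x)) (at x)"
  using assms unfolding C1_on_def by (metis frechet_derivative_at)

lemma C1_on_imp_continuous_on: "C1_on \<Omega> f \<Longrightarrow> continuous_on \<Omega> f"
  by (meson C1_on_has_derivative has_derivative_continuous continuous_at_imp_continuous_on)

lemma continuous_on_frechet_derivative:
  assumes "C1_on \<Omega> f"
  shows "continuous_on \<Omega> (\<lambda>x. frechet_derivative f (at x) v)"
proof -
  obtain f' where f': "\<And>x. x \<in> \<Omega> \<Longrightarrow> (f has_derivative blinfun_apply (f' x)) (at x)"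
      and cont: "continuous_on \<Omega> f'"
    using assms unfolding C1_on_def by blast
  have "continuous_on \<Omega> (\<lambda>x. blinfun_apply (f' x) v)"
    using cont by (intro continuous_intros)
  then show ?thesis
    by (rule continuous_on_eq) (metis f' frechet_derivative_at)
qed

text \<open>The outer function is given with its derivative, because the derivative of the
  composition has to be exhibited as a continuous family of bounded linear maps.\<close>
lemma C1_on_compose_real:
  fixes u :: "'a::euclidean_space \<Rightarrow> real"
  assumes u: "C1_on \<Omega> u"
    and h: "\<And>t. (h has_real_derivative h' t) (at t)" and cont: "continuous_on UNIV h'"
  shows "C1_on \<Omega> (\<lambda>x. h (u x))"
proof -
  obtain u' where u': "\<And>x. x \<in> \<Omega> \<Longrightarrow> (u has_derivative blinfun_apply (u' x)) (at x)"
      and cont': "continuous_on \<Omega> u'"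
    using u unfolding C1_on_def by blast
  have "((\<lambda>x. h (u x)) has_derivative blinfun_apply (h' (u x) *\<^sub>R u' x)) (at x)" if "x \<in> \<Omega>" for x
    using has_derivative_compose[OF u'[OF that] h[unfolded has_field_derivative_def]]
    by (simp add: scaleR_blinfun.rep_eq)
  moreover have "continuous_on \<Omega> (\<lambda>x. h' (u x) *\<^sub>R u' x)"
    using cont' continuous_on_compose2[OF cont C1_on_imp_continuous_on[OF u]]
    by (intro continuous_intros) auto
  ultimately show ?thesis
    unfolding C1_on_def by (intro exI[of _ "\<lambda>x. h' (u x) *\<^sub>R u' x"]) auto
qed

lemma C1_on_mult:
  fixes f g :: "'a::euclidean_space \<Rightarrow> real"
  assumes f: "C1_on \<Omega> f" and g: "C1_on \<Omega> g"
  shows "C1_on \<Omega> (\<lambda>x. f x * g x)"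
proof -
  obtain f' where f': "\<And>x. x \<in> \<Omega> \<Longrightarrow> (f has_derivative blinfun_apply (f' x)) (at x)"
      and cf: "continuous_on \<Omega> f'"
    using f unfolding C1_on_def by blast
  obtain g' where g': "\<And>x. x \<in> \<Omega> \<Longrightarrow> (g has_derivative blinfun_apply (g' x)) (at x)"
      and cg: "continuous_on \<Omega> g'"
    using g unfolding C1_on_def by blast
  have "((\<lambda>x. f x * g x) has_derivative blinfun_apply (f x *\<^sub>R g' x + g x *\<^sub>R f' x)) (at x)"
    if "x \<in> \<Omega>" for x
    using has_derivative_mult[OF f'[OF that] g'[OF that]]
    by (simp add: scaleR_blinfun.rep_eq plus_blinfun.rep_eq mult.commute)
  moreover have "continuous_on \<Omega> (\<lambda>x. f x *\<^sub>R g' x + g x *\<^sub>R f' x)"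
    using cf cg C1_on_imp_continuous_on[OF f] C1_on_imp_continuous_on[OF g]
    by (intro continuous_intros)
  ultimately show ?thesis
    unfolding C1_on_def by (intro exI[of _ "\<lambda>x. f x *\<^sub>R g' x + g x *\<^sub>R f' x"]) auto
qed

lemma C1_on_vec_nth:
  fixes F :: "'a::euclidean_space \<Rightarrow> real^'n"
  assumes F: "C1_on \<Omega> F"
  shows "C1_on \<Omega> (\<lambda>x. F x $ i)"
proof -
  obtain F' where F': "\<And>x. x \<in> \<Omega> \<Longrightarrow> (F has_derivative blinfun_apply (F' x)) (at x)"
      and cF: "continuous_on \<Omega> F'"
    using F unfolding C1_on_def by blast
  define P :: "(real^'n) \<Rightarrow>\<^sub>L real" where "P = Blinfun (\<lambda>y. y $ i)"
  have P: "blinfun_apply P = (\<lambda>y. y $ i)"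
    unfolding P_def by (rule bounded_linear_Blinfun_apply[OF bounded_linear_vec_nth])
  have "((\<lambda>x. F x $ i) has_derivative blinfun_apply (P o\<^sub>L F' x)) (at x)" if "x \<in> \<Omega>" for x
    using has_derivative_compose[OF F'[OF that] bounded_linear_imp_has_derivative[OF bounded_linear_vec_nth]]
    by (simp add: blinfun_compose.rep_eq P o_def)
  moreover have "continuous_on \<Omega> (\<lambda>x. P o\<^sub>L F' x)"
    using cF by (intro continuous_intros)
  ultimately show ?thesis
    unfolding C1_on_def by (intro exI[of _ "\<lambda>x. P o\<^sub>L F' x"]) auto
qed

lemma frechet_derivative_eq_grad:
  fixes f :: "real^'n \<Rightarrow> real"
  assumes "C1_on \<Omega> f" "x \<in> \<Omega>"
  shows "frechet_derivative f (at x) = (\<lambda>h. h \<bullet> grad f x)"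
proof
  fix h :: "real^'n"
  interpret bounded_linear "frechet_derivative f (at x)"
    using C1_on_has_derivative[OF assms] by (rule has_derivative_bounded_linear)
  have "frechet_derivative f (at x) h
      = frechet_derivative f (at x) (\<Sum>i\<in>UNIV. h $ i *\<^sub>R axis i 1)"
    by (simp add: basis_expansion flip: scalar_mult_eq_scaleR)
  also have "\<dots> = h \<bullet> grad f x"
    by (simp add: sum scale grad_def inner_vec_def)
  finally show "frechet_derivative f (at x) h = h \<bullet> grad f x" .
qed

lemma continuous_on_grad:
  assumes "C1_on \<Omega> f"
  shows "continuous_on \<Omega> (grad f)"
  unfolding grad_def
  using continuous_on_frechet_derivative[OF assms] by (intro continuous_on_vec_lambda)

lemma continuous_on_divergence:
  assumes "C1_on \<Omega> F"
  shows "continuous_on \<Omega> (divergence F)"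
  unfolding divergence_def
  using continuous_on_frechet_derivative[OF assms] by (intro continuous_intros)

text \<open>The complement of the closed support in the open set is open, and the function vanishes
  identically there.\<close>
lemma frechet_derivative_eq_0_off_support:
  assumes "open \<Omega>" "x \<in> \<Omega>" "x \<notin> closure (support_on \<Omega> f)"
  shows "frechet_derivative f (at x) = (\<lambda>h. 0)"
proof -
  have "(f has_derivative (\<lambda>h. 0)) (at x)"
  proof (rule has_derivative_transform_within_open[OF has_derivative_const])
    show "open (\<Omega> - closure (support_on \<Omega> f))"
      using assms(1) by auto
    show "0 = f y" if "y \<in> \<Omega> - closure (support_on \<Omega> f)" for y
      using that closure_subset[of "support_on \<Omega> f"] by (auto simp: support_on_def)
  qed (use assms in auto)
  then show ?thesis
    by (rule frechet_derivative_at[symmetric])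
qed

text \<open>Used for a product with a compactly supported factor and for powers of a compactly
  supported function: their closed supports lie in a compact one.\<close>
lemma C1_compact_support_on_subset:
  assumes "C1_on \<Omega> g" "C1_compact_support_on \<Omega> f" "support_on \<Omega> g \<subseteq> support_on \<Omega> f"
  shows "C1_compact_support_on \<Omega> g"
  using assms closure_mono[OF assms(3)] unfolding C1_compact_support_on_def
  by (metis closed_closure compact_Int_closed inf.absorb_iff2 subset_trans)

lemma set_integrable_compact_support:
  fixes f :: "'a::euclidean_space \<Rightarrow> real"
  assumes "compact K" "K \<subseteq> \<Omega>" "continuous_on \<Omega> f"
    and zero: "\<And>x. x \<in> \<Omega> \<Longrightarrow> x \<notin> K \<Longrightarrow> f x = 0"
  shows "set_integrable lborel \<Omega> f"
proof -
  have "set_integrable lborel K f"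
    by (rule borel_integrable_compact[OF assms(1), of f, folded set_integrable_def, simplified])
       (use assms in \<open>auto intro: continuous_on_subset\<close>)
  moreover have "indicator \<Omega> x *\<^sub>R f x = indicator K x *\<^sub>R f x" for x
    using zero assms(2) by (auto simp: indicator_def)
  ultimately show ?thesis
    by (simp only: set_integrable_def)
qed

section \<open>Integration by parts\<close>

lemma lborel_integral_translate:
  fixes f :: "'a::euclidean_space \<Rightarrow> 'b::{banach, second_countable_topology}"
  assumes "integrable lborel f"
  shows "integrable lborel (\<lambda>x. f (x + c))" "(LINT x|lborel. f (x + c)) = (LINT x|lborel. f x)"
proof -
  have f: "f \<in> borel_measurable borel"
    using assms by auto
  have "integrable (distr lborel borel ((+) c)) f"
    using assms by (simp add: lborel_distr_plus)
  then show "integrable lborel (\<lambda>x. f (x + c))"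
    using f by (simp add: integrable_distr_eq add.commute)
  have "(LINT x|lborel. f x) = (LINT x|distr lborel borel ((+) c). f x)"
    by (simp add: lborel_distr_plus)
  also have "\<dots> = (LINT x|lborel. f (x + c))"
    using f by (simp add: integral_distr add.commute)
  finally show "(LINT x|lborel. f (x + c)) = (LINT x|lborel. f x)" ..
qed

text \<open>The function, extended by zero, is differentiable and Lipschitz on the whole space. Its
  difference quotients in direction \<open>v\<close> have integral zero by translation invariance of Lebesgue
  measure. They are bounded by the Lipschitz constant times \<open>norm v\<close> and are supported in one fixed
  ball, so dominated convergence carries the zero over to their limit, the derivative.\<close>
lemma integral_frechet_derivative_eq_0:
  fixes g :: "'a::euclidean_space \<Rightarrow> real"
  assumes "open \<Omega>" and g: "C1_compact_support_on \<Omega> g"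
  shows "(LINT x:\<Omega>|lborel. frechet_derivative g (at x) v) = 0"
proof -
  define K where "K = closure (support_on \<Omega> g)"
  have K: "compact K" "K \<subseteq> \<Omega>" and C1: "C1_on \<Omega> g"
    using g by (auto simp: C1_compact_support_on_def K_def)
  have g0: "g x = 0" if "x \<in> \<Omega>" "x \<notin> K" for x
    using that closure_subset[of "support_on \<Omega> g"] by (auto simp: K_def support_on_def)
  obtain g' where g': "\<And>x. x \<in> \<Omega> \<Longrightarrow> (g has_derivative blinfun_apply (g' x)) (at x)"
      and cont: "continuous_on \<Omega> g'"
    using C1 unfolding C1_on_def by blast
  have g'_eq: "blinfun_apply (g' x) = frechet_derivative g (at x)" if "x \<in> \<Omega>" for x
    using g'[OF that] by (rule frechet_derivative_at)
  \<comment> \<open>The function and its derivative, both extended by zero.\<close>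
  define G where "G x = indicator \<Omega> x * g x" for x
  define D where "D x = (if x \<in> \<Omega> then g' x else 0)" for x
  have G0: "G x = 0" if "x \<notin> K" for x
    using g0 that by (auto simp: G_def indicator_def)
  have D0: "D x = 0" if "x \<notin> K" for x
    using frechet_derivative_eq_0_off_support[OF \<open>open \<Omega>\<close>, of x g] that
    by (auto simp: D_def K_def g'_eq intro!: blinfun_eqI)
  have der: "(G has_derivative blinfun_apply (D x)) (at x)" for x
  proof (cases "x \<in> \<Omega>")
    case True
    show ?thesis
    proof (rule has_derivative_transform_within_open)
      show "(g has_derivative blinfun_apply (D x)) (at x)"
        using g' True by (simp add: D_def)
    qed (use True \<open>open \<Omega>\<close> in \<open>auto simp: G_def\<close>)
  next
    case False
    then have "x \<notin> K" using K by auto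
    show ?thesis
    proof (rule has_derivative_transform_within_open)
      show "((\<lambda>x. 0) has_derivative blinfun_apply (D x)) (at x)"
        using False by (simp add: D_def zero_blinfun.rep_eq has_derivative_const)
      show "open (- K)"
        using K by (simp add: compact_imp_closed open_Compl)
    qed (use \<open>x \<notin> K\<close> G0 in auto)
  qed
  have "compact (g' ` K)"
    using K cont by (meson compact_continuous_image continuous_on_subset)
  then obtain B where "B > 0" and B: "\<And>x. x \<in> K \<Longrightarrow> norm (g' x) \<le> B"
    by (metis bounded_pos compact_imp_bounded imageI)
  have DB: "norm (D x) \<le> B" for x
    using B[of x] K D0[of x] \<open>B > 0\<close> by (cases "x \<in> K") (auto simp: D_def)
  have lip: "norm (G y - G x) \<le> B * norm (y - x)" for x y
    by (rule differentiable_bound[of UNIV G "\<lambda>x. blinfun_apply (D x)"])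
       (use der DB in \<open>auto simp: norm_blinfun.rep_eq\<close>)
  have intG: "integrable lborel G"
    using set_integrable_compact_support[OF K C1_on_imp_continuous_on[OF C1] g0]
    by (simp add: set_integrable_def G_def[abs_def])
  define q where "q n x = (G (x + v /\<^sub>R real (Suc n)) - G x) * real (Suc n)" for n x
  have q_int: "(LINT x|lborel. q n x) = 0" for n
    using lborel_integral_translate[OF intG, of "v /\<^sub>R real (Suc n)"] intG
    by (simp add: q_def)
  have q_lim: "(\<lambda>n. q n x) \<longlonglongrightarrow> blinfun_apply (D x) v" for x
  proof -
    have "((\<lambda>t. x + t *\<^sub>R v) has_derivative (\<lambda>t. t *\<^sub>R v)) (at 0)"
      by (auto intro!: derivative_eq_intros)
    from has_derivative_compose[OF this, of G "blinfun_apply (D x)"] der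
    have "((\<lambda>t. G (x + t *\<^sub>R v)) has_derivative (\<lambda>t. blinfun_apply (D x) v * t)) (at 0)"
      by (simp add: blinfun.scaleR_right mult.commute)
    then have "((\<lambda>t. G (x + t *\<^sub>R v)) has_real_derivative blinfun_apply (D x) v) (at 0)"
      by (simp add: has_field_derivative_def)
    then have "((\<lambda>t. (G (x + t *\<^sub>R v) - G x) / t) \<longlongrightarrow> blinfun_apply (D x) v) (at 0)"
      by (simp add: DERIV_def)
    moreover have "filterlim (\<lambda>n. inverse (real (Suc n))) (at 0) sequentially"
      using LIMSEQ_inverse_real_of_nat by (intro filterlim_atI) auto
    ultimately show ?thesis
      by (rule filterlim_compose[THEN filterlim_cong[THEN iffD1, rotated -1]])
         (auto simp: q_def divide_inverse)
  qed
  obtain R where R: "K \<subseteq> cball 0 R"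
    using compact_imp_bounded[OF K(1)] unfolding bounded_iff by (metis mem_cball_0 subsetI)
  \<comment> \<open>The shifts have length at most \<open>norm v\<close>, so this ball contains the support of every quotient.\<close>
  define C where "C = cball (0::'a) (R + norm v)"
  have step: "norm (v /\<^sub>R real (Suc n)) \<le> norm v" for n
    using mult_left_mono[of 1 "1 + real n" "norm v"] by (simp add: divide_simps flip: divide_inverse)
  have q_bound: "norm (q n x) \<le> B * norm v * indicator C x" for n x
  proof (cases "x \<in> C")
    case True
    have "norm (q n x) \<le> (B * norm (v /\<^sub>R real (Suc n))) * real (Suc n)"
      using lip[of "x + v /\<^sub>R real (Suc n)" x] unfolding q_def abs_mult real_norm_def
      by (intro mult_mono) auto
    also have "\<dots> = B * norm v"
      by simp
    finally show ?thesis
      using True by simp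
  next
    case False
    then have x: "norm x > R + norm v"
      by (auto simp: C_def)
    then have "norm (x + v /\<^sub>R real (Suc n)) > R"
      using step[of n] norm_diff_ineq[of x "v /\<^sub>R real (Suc n)"] by linarith
    moreover have "norm x > R"
      using x norm_ge_zero[of v] by linarith
    ultimately have "x + v /\<^sub>R real (Suc n) \<notin> K" "x \<notin> K"
      using R by (auto simp del: norm_scaleR)
    then show ?thesis
      using G0 False by (simp add: q_def)
  qed
  have meas: "G \<in> borel_measurable borel"
    using intG by auto
  have measD: "(\<lambda>x. blinfun_apply (D x) v) \<in> borel_measurable lborel"
    by (rule borel_measurable_LIMSEQ_real[OF q_lim]) (use meas in \<open>simp add: q_def\<close>)
  have "(\<lambda>n. LINT x|lborel. q n x) \<longlonglongrightarrow> (LINT x|lborel. blinfun_apply (D x) v)"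
  proof (rule integral_dominated_convergence)
    show "integrable lborel (\<lambda>x. B * norm v * indicator C x)"
      unfolding C_def
      by (intro integrable_mult_right integrable_real_indicator emeasure_bounded_finite bounded_cball) simp
  qed (use measD meas q_lim q_bound in \<open>auto simp: q_def\<close>)
  then have "(LINT x|lborel. blinfun_apply (D x) v) = 0"
    by (simp add: q_int LIMSEQ_const_iff)
  moreover have "(LINT x:\<Omega>|lborel. frechet_derivative g (at x) v) = (LINT x|lborel. blinfun_apply (D x) v)"
    unfolding set_lebesgue_integral_def
    by (intro Bochner_Integration.integral_cong) (auto simp: D_def g'_eq indicator_def)
  ultimately show ?thesis
    by simp
qed

text \<open>Summing over \<open>i\<close> the vanishing integrals of the \<open>i\<close>-th partial derivative of
  \<open>\<phi> F\<^sub>i\<close> gives the vanishing of the integral of \<open>div (\<phi> F) = \<phi> div F + F \<bullet> grad \<phi>\<close>.\<close>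
lemma integral_divergence_by_parts:
  fixes F :: "real^'n \<Rightarrow> real^'n"
  assumes "open \<Omega>" and F: "C1_on \<Omega> F" and \<phi>: "C1_compact_support_on \<Omega> \<phi>"
  shows "(LINT x:\<Omega>|lborel. divergence F x * \<phi> x) = - (LINT x:\<Omega>|lborel. F x \<bullet> grad \<phi> x)"
proof -
  define K where "K = closure (support_on \<Omega> \<phi>)"
  have K: "compact K" "K \<subseteq> \<Omega>" and C1: "C1_on \<Omega> \<phi>"
    using \<phi> by (auto simp: C1_compact_support_on_def K_def)
  have \<phi>0: "\<phi> x = 0" if "x \<in> \<Omega>" "x \<notin> K" for x
    using that closure_subset[of "support_on \<Omega> \<phi>"] by (auto simp: K_def support_on_def)
  have grad0: "grad \<phi> x = 0" if "x \<in> \<Omega>" "x \<notin> K" for x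
    using frechet_derivative_eq_0_off_support[OF \<open>open \<Omega>\<close>, of x \<phi>] that
    by (simp add: grad_def K_def zero_vec_def)
  let ?d = "\<lambda>i x. frechet_derivative (\<lambda>x. \<phi> x * F x $ i) (at x) (axis i 1)"
  have comp: "C1_compact_support_on \<Omega> (\<lambda>x. \<phi> x * F x $ i)" for i
    by (rule C1_compact_support_on_subset[OF C1_on_mult[OF C1 C1_on_vec_nth[OF F]] \<phi>])
       (auto simp: support_on_def)
  have d_eq: "?d i x = \<phi> x * frechet_derivative F (at x) (axis i 1) $ i + grad \<phi> x $ i * F x $ i"
    if "x \<in> \<Omega>" for i x
  proof -
    have "((\<lambda>x. F x $ i) has_derivative (\<lambda>h. frechet_derivative F (at x) h $ i)) (at x)"
      using has_derivative_compose[OF C1_on_has_derivative[OF F that]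
          bounded_linear_imp_has_derivative[OF bounded_linear_vec_nth]] .
    from has_derivative_mult[OF C1_on_has_derivative[OF C1 that] this]
    show ?thesis
      by (simp add: frechet_derivative_at[symmetric] grad_def)
  qed
  have sum_d: "(\<Sum>i\<in>UNIV. ?d i x) = divergence F x * \<phi> x + F x \<bullet> grad \<phi> x" if "x \<in> \<Omega>" for x
    using that by (simp add: d_eq sum.distrib divergence_def inner_vec_def sum_distrib_left
        mult.commute cong: sum.cong)
  have int_d: "set_integrable lborel \<Omega> (?d i)" for i
  proof (rule set_integrable_compact_support[OF K])
    show "continuous_on \<Omega> (?d i)"
      using comp by (intro continuous_on_frechet_derivative) (simp add: C1_compact_support_on_def)
  qed (simp add: d_eq \<phi>0 grad0)
  have int1: "set_integrable lborel \<Omega> (\<lambda>x. divergence F x * \<phi> x)"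
    by (rule set_integrable_compact_support[OF K])
       (use \<phi>0 in \<open>auto intro!: continuous_intros continuous_on_divergence F C1_on_imp_continuous_on[OF C1]\<close>)
  have int2: "set_integrable lborel \<Omega> (\<lambda>x. F x \<bullet> grad \<phi> x)"
    by (rule set_integrable_compact_support[OF K])
       (use grad0 in \<open>auto intro!: continuous_intros continuous_on_grad C1 C1_on_imp_continuous_on[OF F]\<close>)
  have "0 = (\<Sum>i\<in>UNIV. LINT x:\<Omega>|lborel. ?d i x)"
    using integral_frechet_derivative_eq_0[OF \<open>open \<Omega>\<close> comp] by simp
  also have "\<dots> = (LINT x:\<Omega>|lborel. (\<Sum>i\<in>UNIV. ?d i x))"
    using int_d unfolding set_lebesgue_integral_def set_integrable_def
    by (subst Bochner_Integration.integral_sum[symmetric]) (simp_all only: scaleR_sum_right)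
  also have "\<dots> = (LINT x:\<Omega>|lborel. divergence F x * \<phi> x + F x \<bullet> grad \<phi> x)"
    using \<open>open \<Omega>\<close> by (intro set_lebesgue_integral_cong) (auto simp: sum_d)
  also have "\<dots> = (LINT x:\<Omega>|lborel. divergence F x * \<phi> x) + (LINT x:\<Omega>|lborel. F x \<bullet> grad \<phi> x)"
    by (rule set_integral_add[OF int1 int2])
  finally show ?thesis
    by linarith
qed

text \<open>The classical and the distributional meaning of the divergence agree.\<close>
lemma div_integral_eq:
  assumes "open \<Omega>" "C1_compact_support_on \<Omega> \<phi>"
  shows "div_integral \<Omega> F \<phi> = - (LINT x:\<Omega>|lborel. F x \<bullet> grad \<phi> x)"
  using assms by (simp add: div_integral_def integral_divergence_by_parts)

text \<open>Continuity of \<open>V\<close> makes \<open>V \<phi>\<close> integrable, which permits splitting the integral of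
  \<open>(- div F - V) \<phi>\<close>.\<close>
lemma neg_div_minus_integral_eq:
  assumes "open \<Omega>" and \<phi>: "C1_compact_support_on \<Omega> \<phi>" and V: "continuous_on \<Omega> V"
  shows "neg_div_minus_integral \<Omega> F V \<phi>
    = (LINT x:\<Omega>|lborel. F x \<bullet> grad \<phi> x) - (LINT x:\<Omega>|lborel. V x * \<phi> x)"
proof (cases "C1_on \<Omega> F")
  case True
  have \<phi>': "C1_on \<Omega> \<phi>" "compact (closure (support_on \<Omega> \<phi>))" "closure (support_on \<Omega> \<phi>) \<subseteq> \<Omega>"
    using \<phi> by (auto simp: C1_compact_support_on_def)
  have int: "set_integrable lborel \<Omega> (\<lambda>x. f x * \<phi> x)" if "continuous_on \<Omega> f" for f
  proof (rule set_integrable_compact_support[OF \<phi>'(2,3)])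
    show "continuous_on \<Omega> (\<lambda>x. f x * \<phi> x)"
      using that C1_on_imp_continuous_on[OF \<phi>'(1)] by (intro continuous_intros)
  qed (use closure_subset[of "support_on \<Omega> \<phi>"] in \<open>auto simp: support_on_def\<close>)
  have "(- divergence F x - V x) * \<phi> x = - divergence F x * \<phi> x - V x * \<phi> x" for x
    by (simp add: algebra_simps)
  then have "neg_div_minus_integral \<Omega> F V \<phi>
      = (LINT x:\<Omega>|lborel. - divergence F x * \<phi> x - V x * \<phi> x)"
    using True by (simp add: neg_div_minus_integral_def)
  also have "\<dots> = (LINT x:\<Omega>|lborel. - divergence F x * \<phi> x) - (LINT x:\<Omega>|lborel. V x * \<phi> x)"
    by (intro set_integral_diff int V continuous_intros continuous_on_divergence True)
  also have "(LINT x:\<Omega>|lborel. - divergence F x * \<phi> x) = (LINT x:\<Omega>|lborel. F x \<bullet> grad \<phi> x)"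
    using integral_divergence_by_parts[OF \<open>open \<Omega>\<close> True \<phi>]
    by (simp add: set_lebesgue_integral_def)
  finally show ?thesis .
next
  case False
  then show ?thesis
    using assms by (simp add: neg_div_minus_integral_def div_integral_eq)
qed

section \<open>Powers of the absolute value\<close>

lemma norm_powr_scaleR:
  fixes x :: "'a::real_normed_vector"
  shows "norm (norm x powr (p - 2) *\<^sub>R x) = norm x powr (p - 1)"
  using powr_mult_base[of "norm x" "p - 2"] by (simp add: mult.commute)

text \<open>At the origin, where the factor \<open>norm x powr (p - 2)\<close> may blow up, continuity comes from
  the norm of the product, which is \<open>norm x powr (p - 1)\<close> with a positive exponent.\<close>
lemma continuous_on_norm_powr_scaleR:
  assumes "p > 1"
  shows "continuous_on UNIV (\<lambda>x::'a::real_normed_vector. norm x powr (p - 2) *\<^sub>R x)"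
proof (rule continuous_at_imp_continuous_on, rule ballI)
  fix x :: 'a
  show "isCont (\<lambda>x. norm x powr (p - 2) *\<^sub>R x) x"
  proof (cases "x = 0")
    case True
    have "continuous_on UNIV (\<lambda>x::'a. norm x powr (p - 1))"
      using assms by (intro continuous_on_powr' continuous_intros) auto
    then have "((\<lambda>x::'a. norm x powr (p - 1)) \<longlongrightarrow> norm (0::'a) powr (p - 1)) (at 0)"
      unfolding continuous_on_eq_continuous_at[OF open_UNIV] isCont_def by blast
    then have "((\<lambda>x::'a. norm (norm x powr (p - 2) *\<^sub>R x)) \<longlongrightarrow> 0) (at 0)"
      by (simp only: norm_powr_scaleR) simp
    then show ?thesis
      unfolding isCont_def True by (simp only: tendsto_norm_zero_cancel scaleR_zero_right)
  next
    case False
    then show ?thesis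
      by (intro continuous_intros) auto
  qed
qed

text \<open>At \<open>0\<close> the difference quotient of \<open>|t|^p\<close> is \<open>|h|^(p-2) h\<close>, that is, the claimed derivative
  at \<open>h\<close> up to the factor \<open>p\<close>, which tends to \<open>0\<close>. Away from \<open>0\<close> the chain rule applies.\<close>
lemma DERIV_abs_powr:
  fixes t :: real
  assumes "p > 1"
  shows "((\<lambda>t. \<bar>t\<bar> powr p) has_real_derivative p * (\<bar>t\<bar> powr (p - 2) * t)) (at t)"
proof (cases "t = 0")
  case True
  have "((\<lambda>h::real. \<bar>h\<bar> powr (p - 2) * h) \<longlongrightarrow> 0) (at 0)"
    using continuous_on_norm_powr_scaleR[OF assms, where 'a=real]
    by (auto simp: continuous_on_eq_continuous_at isCont_def dest: spec[of _ 0])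
  moreover have "\<bar>h\<bar> powr p / h = \<bar>h\<bar> powr (p - 2) * h" if "h \<noteq> 0" for h :: real
  proof -
    have "\<bar>h\<bar> powr p = \<bar>h\<bar> powr (p - 2) * \<bar>h\<bar> powr 2"
      by (metis diff_add_cancel powr_add)
    then show ?thesis
      using that by (simp add: power2_eq_square)
  qed
  ultimately have "((\<lambda>h::real. \<bar>h\<bar> powr p / h) \<longlongrightarrow> 0) (at 0)"
    by (subst tendsto_cong) (auto simp: eventually_at_filter)
  then show ?thesis
    using True by (simp add: DERIV_def)
next
  case False
  have *: "\<bar>t\<bar> powr (p - 1) * sgn t = \<bar>t\<bar> powr (p - 2) * t"
    using norm_powr_scaleR[of t p, symmetric] by (simp add: mult.assoc abs_mult_sgn abs_mult)
  have abs: "((\<lambda>t. \<bar>t\<bar>) has_real_derivative sgn t) (at t)"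
    using has_derivative_norm[OF False] by (simp add: has_field_derivative_def real_norm_def[abs_def] mult_commute_abs)
  have "((\<lambda>t. \<bar>t\<bar> powr p) has_real_derivative p * \<bar>t\<bar> powr (p - 1) * sgn t) (at t)"
    using False by (auto intro!: derivative_eq_intros abs)
  then show ?thesis
    by (simp add: * mult.assoc)
qed

lemma grad_abs_powr:
  assumes "C1_on \<Omega> u" "p > 1" "x \<in> \<Omega>"
  shows "grad (\<lambda>x. \<bar>u x\<bar> powr p) x = (p * (\<bar>u x\<bar> powr (p - 2) * u x)) *\<^sub>R grad u x"
proof -
  have "((\<lambda>x. \<bar>u x\<bar> powr p) has_derivative
      (\<lambda>h. frechet_derivative u (at x) h * (p * (\<bar>u x\<bar> powr (p - 2) * u x)))) (at x)"
    using has_derivative_compose[OF C1_on_has_derivative[OF assms(1,3)]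
        DERIV_abs_powr[OF assms(2), of "u x", unfolded has_field_derivative_def]]
    by (simp add: mult.commute)
  then show ?thesis
    by (simp add: grad_def frechet_derivative_at[symmetric] vec_eq_iff mult.commute)
qed

lemma C1_compact_support_on_abs_powr:
  assumes "C1_compact_support_on \<Omega> u" "p > 1"
  shows "C1_compact_support_on \<Omega> (\<lambda>x. \<bar>u x\<bar> powr p)"
proof (rule C1_compact_support_on_subset[OF _ assms(1)])
  have "continuous_on UNIV (\<lambda>t::real. p * (\<bar>t\<bar> powr (p - 2) * t))"
    using continuous_on_norm_powr_scaleR[OF assms(2), where 'a=real]
    by (auto intro!: continuous_intros)
  then show "C1_on \<Omega> (\<lambda>x. \<bar>u x\<bar> powr p)"
    using assms by (intro C1_on_compose_real[OF _ DERIV_abs_powr]) (auto simp: C1_compact_support_on_def)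
qed (auto simp: support_on_def)

section \<open>Young's and Hoelder's inequalities\<close>

text \<open>Young's inequality for the numbers \<open>a\<close> and \<open>b^(p-1)\<close> with conjugate exponent \<open>p/(p-1)\<close>,
  multiplied by \<open>p\<close>.\<close>
lemma Young_weighted:
  fixes a b p :: real
  assumes "p > 1" "a \<ge> 0" "b \<ge> 0"
  shows "p * (a * b powr (p - 1)) \<le> a powr p + (p - 1) * b powr p"
proof -
  have "a * b powr (p - 1) \<le> a powr p / p + (b powr (p - 1)) powr (p / (p - 1)) / (p / (p - 1))"
    using assms by (intro Youngs_inequality) (auto simp: field_simps)
  also have "(b powr (p - 1)) powr (p / (p - 1)) = b powr p"
    using assms by (simp add: powr_powr)
  finally have "p * (a * b powr (p - 1)) \<le> p * (a powr p / p + b powr p / (p / (p - 1)))"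
    using assms by (intro mult_left_mono) auto
  also have "\<dots> = a powr p + (p - 1) * b powr p"
    using assms by (simp add: field_simps)
  finally show ?thesis .
qed

text \<open>Young's inequality is integrated for \<open>f\<close> and \<open>g\<close> normalised to \<open>L\<^sup>p\<close>- and \<open>L\<^sup>q\<close>-norm one.
  If one of the norms is zero, normalising is impossible, but then the product vanishes almost
  everywhere. Both functions are assumed to be nonnegative everywhere, so that their real powers
  are the usual ones.\<close>
lemma Holder_inequality_integral:
  fixes f g :: "'a \<Rightarrow> real"
  assumes pq: "p > 1" "q > 1" "1 / p + 1 / q = 1"
    and [measurable]: "f \<in> borel_measurable M" "g \<in> borel_measurable M"
    and nonneg: "\<And>x. f x \<ge> 0" "\<And>x. g x \<ge> 0"
    and int: "integrable M (\<lambda>x. f x powr p)" "integrable M (\<lambda>x. g x powr q)"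
  shows "integrable M (\<lambda>x. f x * g x)"
    and "(LINT x|M. f x * g x)
      \<le> (LINT x|M. f x powr p) powr (1 / p) * (LINT x|M. g x powr q) powr (1 / q)"
proof -
  have Young: "f x * g x \<le> f x powr p / p + g x powr q / q" for x
    using pq nonneg by (intro Youngs_inequality) auto
  show int_fg: "integrable M (\<lambda>x. f x * g x)"
  proof (rule Bochner_Integration.integrable_bound)
    show "integrable M (\<lambda>x. f x powr p / p + g x powr q / q)"
      using int by auto
    show "AE x in M. norm (f x * g x) \<le> norm (f x powr p / p + g x powr q / q)"
      using Young nonneg by (intro AE_I2) (smt (verit) mult_nonneg_nonneg real_norm_def)
  qed auto
  define a where "a = (LINT x|M. f x powr p)"
  define b where "b = (LINT x|M. g x powr q)"
  have "a \<ge> 0" "b \<ge> 0"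
    by (auto simp: a_def b_def)
  have null: "(LINT x|M. f x * g x) = 0" if "a = 0 \<or> b = 0"
  proof (rule integral_eq_zero_AE)
    have "(AE x in M. f x powr p = 0) \<or> (AE x in M. g x powr q = 0)"
      using that int by (auto simp: a_def b_def integral_nonneg_eq_0_iff_AE)
    then show "AE x in M. f x * g x = 0"
      by auto
  qed
  show "(LINT x|M. f x * g x) \<le> a powr (1 / p) * b powr (1 / q)"
  proof (cases "a = 0 \<or> b = 0")
    case True
    then show ?thesis using null by simp
  next
    case False
    then have pos: "a > 0" "b > 0"
      using \<open>a \<ge> 0\<close> \<open>b \<ge> 0\<close> by auto
    define \<alpha> where "\<alpha> = a powr (1 / p)"
    define \<beta> where "\<beta> = b powr (1 / q)"
    have ab: "\<alpha> > 0" "\<beta> > 0" "\<alpha> powr p = a" "\<beta> powr q = b"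
      using pos pq by (auto simp: \<alpha>_def \<beta>_def powr_powr)
    have "(LINT x|M. f x * g x / (\<alpha> * \<beta>)) \<le> (LINT x|M. f x powr p / (a * p) + g x powr q / (b * q))"
    proof (rule integral_mono)
      fix x
      have "(f x / \<alpha>) * (g x / \<beta>) \<le> (f x / \<alpha>) powr p / p + (g x / \<beta>) powr q / q"
        using pq nonneg ab by (intro Youngs_inequality) auto
      then show "f x * g x / (\<alpha> * \<beta>) \<le> f x powr p / (a * p) + g x powr q / (b * q)"
        using ab nonneg by (simp add: powr_divide)
    qed (use int int_fg in auto)
    also have "\<dots> = a / (a * p) + b / (b * q)"
      using int by (simp add: a_def b_def)
    also have "\<dots> = 1"
      using pos pq by simp
    finally have "(LINT x|M. f x * g x) / (\<alpha> * \<beta>) \<le> 1"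
      by simp
    then show ?thesis
      using ab by (simp add: divide_le_eq \<alpha>_def \<beta>_def)
  qed
qed

section \<open>The weighted Hardy inequalities\<close>

text \<open>The second vector is the gradient of \<open>|u|^p\<close> at a point where \<open>u\<close> has the value \<open>t\<close> and
  the gradient \<open>g\<close>. Both powers combine with the length of their vector:
  \<open>|X|^(p-2) X = |X|^(p-1) (X/|X|)\<close>, and likewise for \<open>t\<close>. Where \<open>X = 0\<close>, both sides are \<open>0\<close>.\<close>
lemma p_field_inner_grad_le:
  fixes X g :: "real^'n" and p t A :: real
  assumes "p > 1" "A \<ge> 0"
  shows "(A *\<^sub>R p_field p X) \<bullet> ((p * (\<bar>t\<bar> powr (p - 2) * t)) *\<^sub>R g)
    \<le> p * (A * (\<bar>(X /\<^sub>R norm X) \<bullet> g\<bar> * (norm X * \<bar>t\<bar>) powr (p - 1)))"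
proof -
  define a where "a = (X /\<^sub>R norm X) \<bullet> g"
  have "p_field p X \<bullet> g = norm X powr (p - 1) * a"
    using powr_mult_base[of "norm X" "p - 2"]
    by (cases "X = 0") (simp_all add: p_field_def a_def field_simps)
  moreover have "\<bar>\<bar>t\<bar> powr (p - 2) * t\<bar> = \<bar>t\<bar> powr (p - 1)"
    using norm_powr_scaleR[of t p] by simp
  ultimately have "\<bar>(p_field p X \<bullet> g) * (\<bar>t\<bar> powr (p - 2) * t)\<bar> = \<bar>a\<bar> * (norm X * \<bar>t\<bar>) powr (p - 1)"
    by (simp add: abs_mult powr_mult)
  then have "(p_field p X \<bullet> g) * (\<bar>t\<bar> powr (p - 2) * t) \<le> \<bar>a\<bar> * (norm X * \<bar>t\<bar>) powr (p - 1)"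
    by linarith
  then have "(p * A) * ((p_field p X \<bullet> g) * (\<bar>t\<bar> powr (p - 2) * t))
      \<le> (p * A) * (\<bar>a\<bar> * (norm X * \<bar>t\<bar>) powr (p - 1))"
    using assms by (intro mult_left_mono) auto
  then show ?thesis
    by (simp add: a_def mult_ac)
qed

theorem theorem1p5:
  fixes \<Omega> :: "(real^'n) set" and p :: real
    and A u :: "real^'n \<Rightarrow> real" and X :: "real^'n \<Rightarrow> real^'n"
  assumes "open \<Omega>" and "p > 1"
    and "C1_on \<Omega> A" and "\<forall>x\<in>\<Omega>. A x \<ge> 0"
    and "C1_on \<Omega> X"
    and "C1_compact_support_on \<Omega> u"
  shows
    "(LINT x:\<Omega>|lborel. A x * norm (grad u x) powr p)
       \<ge> (LINT x:\<Omega>|lborel. A x * \<bar>(X x /\<^sub>R norm (X x)) \<bullet> grad u x\<bar> powr p)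
     \<and> (LINT x:\<Omega>|lborel. A x * \<bar>(X x /\<^sub>R norm (X x)) \<bullet> grad u x\<bar> powr p)
       \<ge> neg_div_minus_integral \<Omega> (\<lambda>x. A x *\<^sub>R p_field p (X x))
           (\<lambda>x. (p - 1) * A x * norm (X x) powr p) (\<lambda>x. \<bar>u x\<bar> powr p)
     \<and> (LINT x:\<Omega>|lborel. A x * norm (grad u x) powr p) powr (1 / p)
           * (LINT x:\<Omega>|lborel. A x * norm (X x) powr p * \<bar>u x\<bar> powr p) powr ((p - 1) / p)
       \<ge> (LINT x:\<Omega>|lborel. A x * \<bar>(X x /\<^sub>R norm (X x)) \<bullet> grad u x\<bar> powr p) powr (1 / p)
           * (LINT x:\<Omega>|lborel. A x * norm (X x) powr p * \<bar>u x\<bar> powr p) powr ((p - 1) / p)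
     \<and> (LINT x:\<Omega>|lborel. A x * \<bar>(X x /\<^sub>R norm (X x)) \<bullet> grad u x\<bar> powr p) powr (1 / p)
           * (LINT x:\<Omega>|lborel. A x * norm (X x) powr p * \<bar>u x\<bar> powr p) powr ((p - 1) / p)
       \<ge> - (1 / p) * div_integral \<Omega> (\<lambda>x. A x *\<^sub>R p_field p (X x)) (\<lambda>x. \<bar>u x\<bar> powr p)"
proof -
  define K where "K = closure (support_on \<Omega> u)"
  \<comment> \<open>On the restricted measure, functions that are continuous only on \<open>\<Omega>\<close> are measurable. The
      direction field \<open>X/|X|\<close> need not be continuous at the zeros of \<open>X\<close>, so its integrability has to
      come from measurability and a bound.\<close>
  define M where "M = restrict_space (lborel :: (real^'n) measure) \<Omega>"
  define a where "a x = \<bar>(X x /\<^sub>R norm (X x)) \<bullet> grad u x\<bar>" for x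
  define b where "b x = norm (X x) * \<bar>u x\<bar>" for x
  define \<phi> where "\<phi> = (\<lambda>x. \<bar>u x\<bar> powr p)"
  define F where "F = (\<lambda>x. A x *\<^sub>R p_field p (X x))"
  \<comment> \<open>The exponent conjugate to \<open>p\<close>.\<close>
  define q where "q = p / (p - 1)"
  have q: "q > 1" "1 / p + 1 / q = 1" "(p - 1) * q = p" "1 / q = (p - 1) / p"
    using \<open>p > 1\<close> by (auto simp: q_def field_simps)
  have K: "compact K" "K \<subseteq> \<Omega>" and C1: "C1_on \<Omega> u"
    using assms(6) by (auto simp: C1_compact_support_on_def K_def)
  have \<phi>: "C1_compact_support_on \<Omega> \<phi>"
    unfolding \<phi>_def using assms by (intro C1_compact_support_on_abs_powr)
  have u0: "u x = 0" and grad0: "grad u x = 0" if "x \<in> \<Omega>" "x \<notin> K" for x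
    using that closure_subset[of "support_on \<Omega> u"]
      frechet_derivative_eq_0_off_support[OF \<open>open \<Omega>\<close>, of x u]
    by (auto simp: K_def support_on_def grad_def zero_vec_def)
  have A0: "A x \<ge> 0" if "x \<in> \<Omega>" for x
    using assms(4) that by blast
  have grad_\<phi>: "grad \<phi> x = (p * (\<bar>u x\<bar> powr (p - 2) * u x)) *\<^sub>R grad u x" if "x \<in> \<Omega>" for x
    using grad_abs_powr[OF C1 \<open>p > 1\<close> that] by (simp add: \<phi>_def)

  have cont: "continuous_on \<Omega> A" "continuous_on \<Omega> X" "continuous_on \<Omega> u"
      "continuous_on \<Omega> (grad u)" "continuous_on \<Omega> (grad \<phi>)"
    using assms C1 \<phi> by (auto simp: C1_on_imp_continuous_on continuous_on_grad C1_compact_support_on_def)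
  have contF: "continuous_on \<Omega> F"
    unfolding F_def p_field_def
    by (rule continuous_on_scaleR[OF cont(1)
          continuous_on_compose2[OF continuous_on_norm_powr_scaleR[OF \<open>p > 1\<close>] cont(2) subset_UNIV]])
  have contb: "continuous_on \<Omega> (\<lambda>x. b x powr p)"
    using \<open>p > 1\<close> unfolding b_def
    by (intro continuous_on_powr'[OF _ continuous_on_const] continuous_on_mult continuous_on_norm
        continuous_on_rabs cont) auto
  have spaceM: "space M = \<Omega>"
    by (simp add: M_def space_restrict_space)
  have meas_cont: "f \<in> borel_measurable M" if "continuous_on \<Omega> f" for f :: "real^'n \<Rightarrow> 'z::euclidean_space"
    using borel_measurable_continuous_on_restrict[OF that]
      measurable_cong_sets[OF sets_restrict_space_cong[OF sets_lborel] refl]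
    unfolding M_def by blast
  note [measurable] = cont[THEN meas_cont]
  have [measurable]: "a \<in> borel_measurable M" "b \<in> borel_measurable M"
    unfolding a_def b_def by measurable
  have LINT_M: "(LINT x:\<Omega>|lborel. f x) = (LINT x|M. f x)" for f :: "real^'n \<Rightarrow> real"
    using \<open>open \<Omega>\<close> by (simp add: M_def integral_restrict_space set_lebesgue_integral_def)
  have integrable_M: "integrable M f"
    if "continuous_on \<Omega> f" "\<And>x. x \<in> \<Omega> \<Longrightarrow> x \<notin> K \<Longrightarrow> f x = 0" for f :: "real^'n \<Rightarrow> real"
    using set_integrable_compact_support[OF K that] \<open>open \<Omega>\<close>
    by (simp add: M_def integrable_restrict_space set_integrable_def)

  have a0: "a x \<ge> 0" for x
    by (simp add: a_def)
  have a_le: "a x \<le> norm (grad u x)" for x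
  proof -
    have "a x \<le> norm (X x /\<^sub>R norm (X x)) * norm (grad u x)"
      unfolding a_def by (rule Cauchy_Schwarz_ineq2)
    also have "\<dots> \<le> 1 * norm (grad u x)"
      by (cases "X x = 0") (auto intro: mult_right_mono)
    finally show ?thesis by simp
  qed
  have a_le': "A x * a x powr p \<le> A x * norm (grad u x) powr p" if "x \<in> \<Omega>" for x
    using a_le[of x] A0[OF that] \<open>p > 1\<close> by (intro mult_left_mono powr_mono2) (auto simp: a_def)
  have int_grad: "integrable M (\<lambda>x. A x * norm (grad u x) powr p)"
    using \<open>p > 1\<close> grad0
    by (intro integrable_M continuous_on_mult continuous_on_powr'[OF _ continuous_on_const]
        continuous_on_norm cont) auto
  have int_a: "integrable M (\<lambda>x. A x * a x powr p)"
    by (rule Bochner_Integration.integrable_bound[OF int_grad])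
       (use a_le' A0 in \<open>auto intro!: AE_I2 simp: spaceM abs_mult\<close>)
  have int_b: "integrable M (\<lambda>x. A x * b x powr p)"
    using u0 by (intro integrable_M continuous_on_mult cont contb) (auto simp: b_def)
  have int_F: "integrable M (\<lambda>x. F x \<bullet> grad \<phi> x)"
    by (intro integrable_M continuous_on_inner cont contF) (auto simp: grad_\<phi> u0)

  \<comment> \<open>The weight \<open>A\<close> is distributed over both factors so that \<open>f g\<close>, \<open>f^p\<close> and \<open>g^q\<close> all carry the
      weight \<open>A\<close> to the first power.\<close>
  define f where "f = (\<lambda>x. A x powr (1 / p) * a x)"
  define g where "g = (\<lambda>x. A x powr (1 / q) * b x powr (p - 1))"
  have fg: "f x * g x = A x * (a x * b x powr (p - 1))"
    and fp: "f x powr p = A x * a x powr p"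
    and gq: "g x powr q = A x * b x powr p" if "x \<in> space M" for x
  proof -
    have "A x \<ge> 0"
      using that A0 by (simp add: spaceM)
    moreover have "A x powr (1 / p) * A x powr (1 / q) = A x"
      using q(2) \<open>A x \<ge> 0\<close> by (simp flip: powr_add)
    ultimately show "f x * g x = A x * (a x * b x powr (p - 1))"
        "f x powr p = A x * a x powr p" "g x powr q = A x * b x powr p"
      using q \<open>p > 1\<close> a0[of x]
      by (auto simp: f_def g_def b_def powr_mult powr_powr mult_ac)
  qed
  have Holder: "integrable M (\<lambda>x. A x * (a x * b x powr (p - 1)))"
    "(LINT x|M. A x * (a x * b x powr (p - 1)))
      \<le> (LINT x|M. A x * a x powr p) powr (1 / p) * (LINT x|M. A x * b x powr p) powr (1 / q)"
  proof -
    have meas: "f \<in> borel_measurable M" "g \<in> borel_measurable M"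
      unfolding f_def g_def by measurable
    have nonneg: "f x \<ge> 0" "g x \<ge> 0" for x
      using a0 by (simp_all add: f_def g_def)
    have int: "integrable M (\<lambda>x. f x powr p)" "integrable M (\<lambda>x. g x powr q)"
      using int_a int_b fp gq by (simp_all cong: Bochner_Integration.integrable_cong)
    note H = Holder_inequality_integral[OF \<open>p > 1\<close> q(1,2) meas nonneg int]
    show "integrable M (\<lambda>x. A x * (a x * b x powr (p - 1)))"
      using H(1) by (simp add: fg cong: Bochner_Integration.integrable_cong)
    have "(LINT x|M. f x * g x) = (LINT x|M. A x * (a x * b x powr (p - 1)))"
        "(LINT x|M. f x powr p) = (LINT x|M. A x * a x powr p)"
        "(LINT x|M. g x powr q) = (LINT x|M. A x * b x powr p)"
      by (auto intro!: Bochner_Integration.integral_cong simp: fg fp gq)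
    then show "(LINT x|M. A x * (a x * b x powr (p - 1)))
      \<le> (LINT x|M. A x * a x powr p) powr (1 / p) * (LINT x|M. A x * b x powr p) powr (1 / q)"
      using H(2) by simp
  qed

  have F_le: "F x \<bullet> grad \<phi> x \<le> p * (A x * (a x * b x powr (p - 1)))" if "x \<in> \<Omega>" for x
    using p_field_inner_grad_le[OF \<open>p > 1\<close> A0[OF that]]
    by (simp only: F_def grad_\<phi>[OF that] a_def b_def)
  have F_Young: "F x \<bullet> grad \<phi> x \<le> A x * a x powr p + (p - 1) * (A x * b x powr p)" if "x \<in> \<Omega>" for x
  proof -
    have "A x * (p * (a x * b x powr (p - 1))) \<le> A x * (a x powr p + (p - 1) * b x powr p)"
      using \<open>p > 1\<close> A0[OF that] by (intro mult_left_mono Young_weighted) (auto simp: a_def b_def)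
    then show ?thesis
      using F_le[OF that] by (simp add: algebra_simps)
  qed

  have b_powr: "A x * norm (X x) powr p * \<bar>u x\<bar> powr p = A x * b x powr p" for x
    by (simp add: b_def powr_mult)
  have V: "(p - 1) * A x * norm (X x) powr p * \<phi> x = (p - 1) * (A x * b x powr p)" for x
    by (simp add: \<phi>_def b_def powr_mult)
  have contV: "continuous_on \<Omega> (\<lambda>x. (p - 1) * A x * norm (X x) powr p)"
    using \<open>p > 1\<close>
    by (intro continuous_on_mult continuous_on_powr'[OF _ continuous_on_const] continuous_on_norm
        continuous_on_const cont) auto
  have neg: "neg_div_minus_integral \<Omega> F (\<lambda>x. (p - 1) * A x * norm (X x) powr p) \<phi>
      = (LINT x|M. F x \<bullet> grad \<phi> x) - (p - 1) * (LINT x|M. A x * b x powr p)"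
    unfolding neg_div_minus_integral_eq[OF \<open>open \<Omega>\<close> \<phi> contV]
    by (simp add: LINT_M V)
  have ineq1: "(LINT x|M. A x * a x powr p) \<le> (LINT x|M. A x * norm (grad u x) powr p)"
    using a_le' by (intro integral_mono int_a int_grad) (auto simp: spaceM)
  have ineq2: "(LINT x|M. F x \<bullet> grad \<phi> x)
      \<le> (LINT x|M. A x * a x powr p) + (p - 1) * (LINT x|M. A x * b x powr p)"
  proof -
    have "(LINT x|M. F x \<bullet> grad \<phi> x) \<le> (LINT x|M. A x * a x powr p + (p - 1) * (A x * b x powr p))"
      using F_Young int_a int_b by (intro integral_mono int_F) (auto simp: spaceM)
    then show ?thesis
      using int_a int_b by simp
  qed
  have a_nonneg: "(LINT x|M. A x * a x powr p) \<ge> 0"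
    using A0 by (intro Bochner_Integration.integral_nonneg) (auto simp: spaceM)
  have ineq4: "(LINT x|M. F x \<bullet> grad \<phi> x)
      \<le> p * ((LINT x|M. A x * a x powr p) powr (1 / p) * (LINT x|M. A x * b x powr p) powr (1 / q))"
  proof -
    have "(LINT x|M. F x \<bullet> grad \<phi> x) \<le> (LINT x|M. p * (A x * (a x * b x powr (p - 1))))"
      using F_le Holder(1) by (intro integral_mono int_F) (auto simp: spaceM)
    also have "\<dots> = p * (LINT x|M. A x * (a x * b x powr (p - 1)))"
      by simp
    also have "\<dots> \<le> p * ((LINT x|M. A x * a x powr p) powr (1 / p) * (LINT x|M. A x * b x powr p) powr (1 / q))"
      using Holder(2) \<open>p > 1\<close> by (intro mult_left_mono) auto
    finally show ?thesis .
  qed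
  show ?thesis
    unfolding a_def[symmetric] b_powr \<phi>_def[symmetric] F_def[symmetric]
      neg div_integral_eq[OF \<open>open \<Omega>\<close> \<phi>] LINT_M q(4)[symmetric]
    using ineq1 ineq2 ineq4 a_nonneg \<open>p > 1\<close>
    by (intro conjI mult_right_mono powr_mono2) (auto simp: field_simps)
qed

end
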